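(* Suppose that $A=(A_1,\dots,A_n)$ and $B=(B_1,\dots,B_n)$ are similar contractive $n$-tuples in $\mathcal B(\mathcal V)$, where $\mathcal V$ is a finite dimensional Hilbert space. Let $S=(S_1,\dots,S_n)$ and $T=(T_1,\dots,T_n)$ be their respective minimal joint isometric dilations. Then the Cuntz parts of $S$ and $T$ are unitarily equivalent.
   Context: Fix an integer $n\ge2$. An $n$-tuple $A$ is contractive if $\sum_iA_iA_i^*\le I$. $A$ and $B$ are similar if there is one invertible $R\in\mathcal B(\mathcal V)$ with $B_i=RA_iR^{-1}$ for all $i$. The minimal joint isometric dilation of $A$ is an $n$-tuple $S$ of isometries with pairwise orthogonal ranges on $\mathcal H\supseteq\mathcal V$ with $\mathcal V$ invariant for each $S_i^*$, $S_i^*|_{\mathcal V}=A_i^*$, and $\mathcal H$ the closed span of $\{S_w\mathcal V\}$, where $w=i_1\cdots i_k$ ranges over all words (including the empty one) in $1,\dots,n$ and $S_w=S_{i_1}\cdots S_{i_k}$; it exists and is unique up to a unitary equivalence fixing $\mathcal V$. Put $\mathcal X=\operatorname{Ran}(I-\sum_iS_iS_i^* )$; the subspaces $S_w\mathcal X$ are pairwise orthogonal, $\mathcal H_p=\sum^\oplus_wS_w\mathcal X$ reduces every $S_i$, and the Cuntz part of $S$ is the $n$-tuple of restrictions $S_i|_{\mathcal H_c}$, where $\mathcal H_c=\mathcal H_p^\perp$ (possibly zero). Unitary equivalence of $n$-tuples means that one unitary intertwines all entries. *)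

theory Defs
  imports "HOL-Analysis.Analysis"
begin

section \<open>Complex Hilbert spaces\<close>

text \<open>
  The norm, the topology and completeness are those of the underlying real Hilbert space, whose
  inner product is the real part of the complex one. The complex inner product is linear in its
  first argument; its definiteness follows from that of the real inner product.
\<close>

class complex_hilbert_space = real_inner + complete_space +
  fixes scaleC :: "complex \<Rightarrow> 'a \<Rightarrow> 'a" (infixr \<open>*\<^sub>C\<close> 75)
    and cinner :: "'a \<Rightarrow> 'a \<Rightarrow> complex"
  assumes scaleC_add_right: "c *\<^sub>C (x + y) = c *\<^sub>C x + c *\<^sub>C y"
    and scaleC_add_left: "(c + d) *\<^sub>C x = c *\<^sub>C x + d *\<^sub>C x"
    and scaleC_scaleC: "c *\<^sub>C d *\<^sub>C x = (c * d) *\<^sub>C x"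
    and scaleC_of_real: "complex_of_real r *\<^sub>C x = r *\<^sub>R x"
    and cinner_commute: "cinner x y = cnj (cinner y x)"
    and cinner_add_left: "cinner (x + y) z = cinner x z + cinner y z"
    and cinner_scaleC_left: "cinner (c *\<^sub>C x) y = c * cinner x y"
    and Re_cinner: "Re (cinner x y) = inner x y"

instantiation complex :: complex_hilbert_space
begin

definition scaleC_complex :: "complex \<Rightarrow> complex \<Rightarrow> complex"
  where "scaleC_complex c x = c * x"

definition cinner_complex :: "complex \<Rightarrow> complex \<Rightarrow> complex"
  where "cinner_complex x y = x * cnj y"

instance
  by standard
    (simp_all add: scaleC_complex_def cinner_complex_def inner_complex_def scaleR_conv_of_real
      algebra_simps)

end

lemma scaleC_one: "1 *\<^sub>C x = (x :: 'a::complex_hilbert_space)"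
  using scaleC_of_real[of 1 x] by simp

global_interpretation complex_vector: vector_space "scaleC :: complex \<Rightarrow> 'a \<Rightarrow> 'a::complex_hilbert_space"
  by standard (simp_all add: scaleC_add_right scaleC_add_left scaleC_scaleC scaleC_one)

definition finite_dimensional :: "'a::complex_hilbert_space itself \<Rightarrow> bool"
  where "finite_dimensional _ \<longleftrightarrow>
    (\<exists>B :: 'a set. finite B \<and> complex_vector.span B = UNIV)"

definition orthogonal_complement :: "'a::complex_hilbert_space set \<Rightarrow> 'a set"
  where "orthogonal_complement M = {x. \<forall>y\<in>M. cinner x y = 0}"


section \<open>Bounded operators\<close>

definition bounded_clinear :: "('a::complex_hilbert_space \<Rightarrow> 'b::complex_hilbert_space) \<Rightarrow> bool"
  where "bounded_clinear f \<longleftrightarrow> bounded_linear f \<and> (\<forall>c x. f (c *\<^sub>C x) = c *\<^sub>C f x)"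

text \<open>Existence of the adjoint of a bounded operator is the Riesz representation theorem.\<close>

definition cadjoint ::
    "('a::complex_hilbert_space \<Rightarrow> 'b::complex_hilbert_space) \<Rightarrow> 'b \<Rightarrow> 'a"
  where "cadjoint f = (THE g. \<forall>x y. cinner (f x) y = cinner x (g y))"

lemma cadjoint_eqI:
  assumes "\<And>x y. cinner (f x) y = cinner x (g y)"
  shows "cadjoint f = g"
  unfolding cadjoint_def
proof (rule the_equality)
  fix h assume h: "\<forall>x y. cinner (f x) y = cinner x (h y)"
  have "inner x (h y) = inner x (g y)" for x y
    using h assms by (metis Re_cinner)
  then show "h = g"
    by (metis ext vector_eq_rdot inner_commute)
qed (use assms in blast)

definition positive_operator :: "('a::complex_hilbert_space \<Rightarrow> 'a) \<Rightarrow> bool"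
  where "positive_operator P \<longleftrightarrow>
    bounded_clinear P \<and> (\<forall>x. Im (cinner (P x) x) = 0 \<and> 0 \<le> Re (cinner (P x) x))"

definition isometry :: "('a::complex_hilbert_space \<Rightarrow> 'b::complex_hilbert_space) \<Rightarrow> bool"
  where "isometry f \<longleftrightarrow> bounded_clinear f \<and> (\<forall>x. norm (f x) = norm x)"


section \<open>Tuples of operators\<close>

text \<open>
  An \<open>n\<close>-tuple is a family indexed by a finite type \<open>'i\<close> with \<open>CARD('i) = n\<close>; words in the index
  set are lists over \<open>'i\<close>.
\<close>

definition contractive_tuple :: "('i::finite \<Rightarrow> 'a::complex_hilbert_space \<Rightarrow> 'a) \<Rightarrow> bool"
  where "contractive_tuple A \<longleftrightarrow>
    (\<forall>i. bounded_clinear (A i)) \<and>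
    positive_operator (\<lambda>x. x - (\<Sum>i\<in>UNIV. A i (cadjoint (A i) x)))"

definition similar_tuples ::
    "('i \<Rightarrow> 'a::complex_hilbert_space \<Rightarrow> 'a) \<Rightarrow> ('i \<Rightarrow> 'a \<Rightarrow> 'a) \<Rightarrow> bool"
  where "similar_tuples A B \<longleftrightarrow>
    (\<exists>R R'. bounded_clinear R \<and> bounded_clinear R' \<and> R \<circ> R' = id \<and> R' \<circ> R = id \<and>
      (\<forall>i. B i = R \<circ> A i \<circ> R'))"

definition word_op :: "('i \<Rightarrow> 'a \<Rightarrow> 'a) \<Rightarrow> 'i list \<Rightarrow> 'a \<Rightarrow> 'a"
  where "word_op S w = foldr (\<lambda>i f. S i \<circ> f) w id"

text \<open>
  The inclusion of \<open>\<V>\<close> in the dilation space is represented by an isometric embedding \<open>J\<close>. The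
  equation on adjoints expresses both that the range of \<open>J\<close> is invariant under the adjoint of
  each \<open>S i\<close> and that the restriction to it is the adjoint of \<open>A i\<close>.
\<close>

definition minimal_isometric_dilation ::
    "('i \<Rightarrow> 'v::complex_hilbert_space \<Rightarrow> 'v) \<Rightarrow> ('v \<Rightarrow> 'h::complex_hilbert_space) \<Rightarrow>
     ('i \<Rightarrow> 'h \<Rightarrow> 'h) \<Rightarrow> bool"
  where "minimal_isometric_dilation A J S \<longleftrightarrow>
    isometry J \<and>
    (\<forall>i. isometry (S i)) \<and>
    (\<forall>i j x y. i \<noteq> j \<longrightarrow> cinner (S i x) (S j y) = 0) \<and>
    (\<forall>i v. cadjoint (S i) (J v) = J (cadjoint (A i) v)) \<and>
    closure (complex_vector.span (\<Union>w. word_op S w ` range J)) = UNIV"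

definition wandering_space :: "('i::finite \<Rightarrow> 'h::complex_hilbert_space \<Rightarrow> 'h) \<Rightarrow> 'h set"
  where "wandering_space S = range (\<lambda>x. x - (\<Sum>i\<in>UNIV. S i (cadjoint (S i) x)))"

text \<open>The Hilbert space direct sum of pairwise orthogonal subspaces is the closure of their span.\<close>

definition pure_space :: "('i::finite \<Rightarrow> 'h::complex_hilbert_space \<Rightarrow> 'h) \<Rightarrow> 'h set"
  where "pure_space S =
    closure (complex_vector.span (\<Union>w. word_op S w ` wandering_space S))"

definition cuntz_space :: "('i::finite \<Rightarrow> 'h::complex_hilbert_space \<Rightarrow> 'h) \<Rightarrow> 'h set"
  where "cuntz_space S = orthogonal_complement (pure_space S)"

text \<open>A tuple of operators on a subspace is a pair of the subspace and the operators on it.\<close>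

definition cuntz_part ::
    "('i::finite \<Rightarrow> 'h::complex_hilbert_space \<Rightarrow> 'h) \<Rightarrow> 'h set \<times> ('i \<Rightarrow> 'h \<Rightarrow> 'h)"
  where "cuntz_part S = (cuntz_space S, \<lambda>i. restrict (S i) (cuntz_space S))"

definition unitary_between ::
    "('h::complex_hilbert_space \<Rightarrow> 'k::complex_hilbert_space) \<Rightarrow> 'h set \<Rightarrow> 'k set \<Rightarrow> bool"
  where "unitary_between U M N \<longleftrightarrow>
    bij_betw U M N \<and>
    (\<forall>x\<in>M. \<forall>y\<in>M. U (x + y) = U x + U y) \<and>
    (\<forall>c. \<forall>x\<in>M. U (c *\<^sub>C x) = c *\<^sub>C U x) \<and>
    (\<forall>x\<in>M. \<forall>y\<in>M. cinner (U x) (U y) = cinner x y)"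

fun unitarily_equivalent ::
    "'h::complex_hilbert_space set \<times> ('i \<Rightarrow> 'h \<Rightarrow> 'h) \<Rightarrow>
     'k::complex_hilbert_space set \<times> ('i \<Rightarrow> 'k \<Rightarrow> 'k) \<Rightarrow> bool"
  where "unitarily_equivalent (M, S) (N, T) \<longleftrightarrow>
    (\<exists>U. unitary_between U M N \<and> (\<forall>i. \<forall>x\<in>M. U (S i x) = T i (U x)))"

end

theory Submission
  imports Defs
begin

text \<open>
  If \<open>B\<^sub>i = R A\<^sub>i R\<^sup>-\<^sup>1\<close>, then \<open>M = (R\<^sup>-\<^sup>1)\<^sup>*\<close> satisfies \<open>M A\<^sub>i\<^sup>* = B\<^sub>i\<^sup>* M\<close>. Averaging the bounded map
  \<open>K M J\<^sup>*\<close> over words, \<open>X = lim\<^sub>k \<Sum>\<^bsub>|w| = k\<^esub> T\<^sub>w K M J\<^sup>* S\<^sub>w\<^sup>*\<close>, yields a bounded operator which intertwines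
  both \<open>S\<^sub>i\<close> with \<open>T\<^sub>i\<close> and \<open>S\<^sub>i\<^sup>*\<close> with \<open>T\<^sub>i\<^sup>*\<close>, and which sends \<open>J v\<close> to the component of \<open>K M v\<close> in the
  Cuntz space of \<open>T\<close>. The same construction with \<open>M\<^sup>-\<^sup>1\<close> yields \<open>Y\<close>, and by minimality \<open>Y X\<close> and
  \<open>X Y\<close> are the projections onto the two Cuntz spaces. So \<open>X\<close> restricts to a similarity of the
  Cuntz parts, and \<open>X\<^sup>* X\<close> commutes with every \<open>S\<^sub>i\<close>; hence the unitary factor of its polar
  decomposition intertwines the Cuntz parts.
\<close>

instance complex_hilbert_space \<subseteq> banach ..

section \<open>Adjoints\<close>

text \<open>Minimizing \<open>\<parallel>x\<parallel>\<^sup>2 - 2 f x\<close> yields the representing vector without first treating closed subspaces.\<close>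

lemma riesz_representation:
  fixes f :: "'a::{real_inner,banach} \<Rightarrow> real"
  assumes "bounded_linear f"
  obtains z where "\<And>x. f x = inner x z"
proof -
  interpret f: bounded_linear f by fact
  define q where "q x = (norm x)\<^sup>2 - 2 * f x" for x
  obtain B where B: "\<And>x. norm (f x) \<le> norm x * B"
    using f.bounded by blast
  have "- B\<^sup>2 \<le> q x" for x
  proof -
    have "f x \<le> norm x * B" using B[of x] by simp
    moreover have "0 \<le> (norm x - B)\<^sup>2" by simp
    ultimately show ?thesis unfolding q_def power2_diff by linarith
  qed
  then have bdd: "bdd_below (range q)" unfolding bdd_below_def by blast
  define m where "m = Inf (range q)"
  have m_le: "m \<le> q x" for x
    unfolding m_def by (rule cInf_lower) (use bdd in auto)
  define d where "d n = inverse (real (Suc n))" for n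
  have "\<exists>x. q x < m + d n" for n
    using cInf_lessD[of "range q" "m + d n"] unfolding m_def d_def by auto
  then obtain u where u: "\<And>n. q (u n) < m + d n" by metis
  \<comment> \<open>The parallelogram law at the midpoint \<open>h\<close>, where \<open>q h\<close>
    is at least \<open>m\<close>: almost minimal points are close together, so a minimizing sequence
    is Cauchy.\<close>
  have par: "(norm (x - y))\<^sup>2 \<le> 2 * (q x - m) + 2 * (q y - m)" for x y
  proof -
    define h where "h = (1/2) *\<^sub>R (x + y)"
    have "q x + q y = 2 * q h + (norm (x - y))\<^sup>2 / 2"
      unfolding q_def h_def f.scaleR f.add
      by (simp add: power_mult_distrib power2_norm_eq_inner inner_simps inner_commute field_simps)
    moreover have "m \<le> q h" by (rule m_le)
    ultimately show ?thesis by (simp add: field_simps)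
  qed
  have "Cauchy u"
  proof (rule metric_CauchyI)
    fix e :: real assume "e > 0"
    then obtain N where N: "d N < e\<^sup>2 / 4"
      using reals_Archimedean[of "e\<^sup>2 / 4"] unfolding d_def by auto
    have "dist (u i) (u j) < e" if "i \<ge> N" "j \<ge> N" for i j
    proof -
      have "d i \<le> d N" "d j \<le> d N"
        using that by (auto simp: d_def intro: le_imp_inverse_le)
      then have "(norm (u i - u j))\<^sup>2 < e\<^sup>2"
        using par[of "u i" "u j"] u[of i] u[of j] N by (simp add: algebra_simps)
      then show ?thesis using \<open>e > 0\<close> by (simp add: dist_norm power2_less_imp_less)
    qed
    then show "\<exists>M. \<forall>i\<ge>M. \<forall>j\<ge>M. dist (u i) (u j) < e" by blast
  qed
  then obtain z where z: "u \<longlonglongrightarrow> z" using Cauchy_convergent convergent_def by blast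
  have "(\<lambda>n. q (u n)) \<longlonglongrightarrow> q z"
    unfolding q_def by (intro tendsto_intros f.tendsto z)
  moreover have "(\<lambda>n. m + d n) \<longlonglongrightarrow> m + 0"
    unfolding d_def by (intro tendsto_intros LIMSEQ_inverse_real_of_nat)
  ultimately have "q z \<le> m + 0"
    by (rule LIMSEQ_le) (use u less_imp_le in blast)
  then have min: "q z \<le> q x" for x using m_le[of x] by simp
  have "f x = inner x z" for x
  proof (cases "x = 0")
    case False
    define c where "c = inner x z - f x"
    \<comment> \<open>\<open>t\<close> minimizes
      \<open>2 * t * c + t\<^sup>2 * (norm x)\<^sup>2\<close>; as \<open>z\<close> minimizes
      \<open>q\<close>, the minimal value \<open>- c\<^sup>2 / (norm x)\<^sup>2\<close> cannot be
      negative, which forces \<open>c = 0\<close>.\<close>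
    define t where "t = - c / (norm x)\<^sup>2"
    have n: "(norm x)\<^sup>2 > 0" using False by simp
    have "(norm (z + t *\<^sub>R x))\<^sup>2 = (norm z)\<^sup>2 + 2 * t * inner x z + t\<^sup>2 * (norm x)\<^sup>2"
      by (simp add: power2_norm_eq_inner inner_simps inner_commute power2_eq_square[of t]
          algebra_simps)
    then have "q (z + t *\<^sub>R x) = q z + 2 * t * c + t\<^sup>2 * (norm x)\<^sup>2"
      unfolding q_def f.scaleR f.add c_def by (simp add: inner_commute algebra_simps)
    also have "\<dots> = q z - c\<^sup>2 / (norm x)\<^sup>2"
      unfolding t_def using n by (simp add: field_simps power2_eq_square)
    finally have "c\<^sup>2 / (norm x)\<^sup>2 \<le> 0" using min[of "z + t *\<^sub>R x"] by simp
    then have "c\<^sup>2 \<le> 0" using n by (simp add: divide_le_0_iff)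
    then have "c = 0" by simp
    then show ?thesis by (simp add: c_def)
  qed simp
  then show ?thesis by (rule that)
qed

text \<open>The real part of a complex inner product is the real one, and multiplying the first
  argument by \<open>- \<i>\<close> moves the imaginary part into the real part. Complex identities
  thereby reduce to real ones.\<close>

lemma cinner_eqI_inner:
  assumes "\<And>c. inner (c *\<^sub>C x) y = inner (c *\<^sub>C u) v"
  shows "cinner x y = cinner u v"
proof (rule complex_eqI)
  show "Re (cinner x y) = Re (cinner u v)"
    using assms[of 1] by (simp add: Re_cinner scaleC_one)
  show "Im (cinner x y) = Im (cinner u v)"
    using assms[of "- \<i>"] by (simp only: cinner_scaleC_left flip: Re_cinner) simp
qed

lemma cinner_scaleC_right: "cinner x (c *\<^sub>C y) = cnj c * cinner x y"
proof -
  have "cinner x (c *\<^sub>C y) = cnj (c * cinner y x)"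
    by (simp only: cinner_commute[of x "c *\<^sub>C y"] cinner_scaleC_left)
  then show ?thesis
    by (simp only: complex_cnj_mult cinner_commute[of x y])
qed

lemma inner_scaleC_left: "inner (c *\<^sub>C x) y = inner x (cnj c *\<^sub>C y)"
  by (simp only: cinner_scaleC_left cinner_scaleC_right complex_cnj_cnj flip: Re_cinner)

lemma bounded_clinear_scaleC: "bounded_clinear f \<Longrightarrow> f (c *\<^sub>C x) = c *\<^sub>C f x"
  by (simp add: bounded_clinear_def)

lemma bounded_clinear_imp_bounded_linear: "bounded_clinear f \<Longrightarrow> bounded_linear f"
  by (simp add: bounded_clinear_def)

lemma bounded_clinear_add: "bounded_clinear f \<Longrightarrow> f (x + y) = f x + f y"
  by (simp add: bounded_clinear_def linear_simps)

lemma bounded_clinear_diff: "bounded_clinear f \<Longrightarrow> f (x - y) = f x - f y"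
  by (simp add: bounded_clinear_def linear_simps)

lemma bounded_clinear_zero: "bounded_clinear f \<Longrightarrow> f 0 = 0"
  by (simp add: bounded_clinear_def linear_simps)

lemma bounded_clinear_sum: "bounded_clinear f \<Longrightarrow> f (\<Sum>i\<in>I. g i) = (\<Sum>i\<in>I. f (g i))"
  by (simp add: bounded_clinear_def bounded_linear.linear linear_sum)

lemma bounded_clinear_tendsto:
  "bounded_clinear f \<Longrightarrow> (g \<longlongrightarrow> l) F \<Longrightarrow> ((\<lambda>x. f (g x)) \<longlongrightarrow> f l) F"
  by (simp add: bounded_clinear_def bounded_linear.tendsto)

lemma bounded_clinear_ident: "bounded_clinear (\<lambda>x. x)"
  by (simp add: bounded_clinear_def bounded_linear_ident)

lemma bounded_clinear_compose:
  "bounded_clinear f \<Longrightarrow> bounded_clinear g \<Longrightarrow> bounded_clinear (\<lambda>x. f (g x))"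
  by (simp add: bounded_clinear_def bounded_linear_compose)

lemma bounded_clinear_sumI:
  assumes "\<And>i. i \<in> I \<Longrightarrow> bounded_clinear (f i)"
  shows "bounded_clinear (\<lambda>x. \<Sum>i\<in>I. f i x)"
  using assms by (auto simp: bounded_clinear_def complex_vector.scale_sum_right
      intro!: bounded_linear_sum sum.cong)

text \<open>Riesz representation of the real functional \<open>\<lambda>x. inner (f x) y\<close>
  gives \<open>g y\<close>; complex linearity of \<open>f\<close> upgrades the real
  identity.\<close>

lemma exists_adjoint:
  assumes f: "bounded_clinear f"
  shows "\<exists>g. \<forall>x y. cinner (f x) y = cinner x (g y)"
proof -
  have "\<exists>z. \<forall>x. inner (f x) y = inner x z" for y
    by (rule riesz_representation[of "\<lambda>x. inner (f x) y"])
      (use bounded_linear_compose[OF bounded_linear_inner_left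
          bounded_clinear_imp_bounded_linear[OF f]] in auto)
  then obtain g where g: "\<And>x y. inner (f x) y = inner x (g y)" by metis
  have "cinner (f x) y = cinner x (g y)" for x y
    by (rule cinner_eqI_inner) (simp add: g flip: bounded_clinear_scaleC[OF f])
  then show ?thesis by blast
qed

lemma cinner_cadjoint:
  assumes "bounded_clinear f"
  shows "cinner (f x) y = cinner x (cadjoint f y)"
  using exists_adjoint[OF assms] cadjoint_eqI by metis

lemma inner_cadjoint:
  "bounded_clinear f \<Longrightarrow> inner (f x) y = inner x (cadjoint f y)"
  using cinner_cadjoint[of f x y] by (simp only: flip: Re_cinner)

lemma inner_cadjoint':
  "bounded_clinear f \<Longrightarrow> inner (cadjoint f y) x = inner y (f x)"
  using inner_cadjoint by (metis inner_commute)

lemma bounded_clinear_cadjoint: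
  assumes f: "bounded_clinear f"
  shows "bounded_clinear (cadjoint f)"
proof -
  obtain B where B: "\<And>x. norm (f x) \<le> norm x * B" "B > 0"
    using bounded_linear.pos_bounded[OF bounded_clinear_imp_bounded_linear[OF f]] by blast
  have "norm (cadjoint f y) \<le> norm y * B" for y
  proof (cases "cadjoint f y = 0")
    case False
    have "norm (cadjoint f y) * norm (cadjoint f y) = inner (f (cadjoint f y)) y"
      by (simp add: inner_cadjoint[OF f] norm_eq_sqrt_inner)
    also have "\<dots> \<le> norm (f (cadjoint f y)) * norm y" by (rule norm_cauchy_schwarz)
    also have "\<dots> \<le> (norm (cadjoint f y) * B) * norm y" by (intro mult_right_mono B) simp
    finally show ?thesis using False by (simp add: mult.commute mult.left_commute)
  qed (use B in simp)
  moreover have "cadjoint f (x + y) = cadjoint f x + cadjoint f y" for x y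
    by (rule vector_eq_rdot[THEN iffD1])
      (simp add: inner_cadjoint'[OF f] inner_simps)
  moreover have "cadjoint f (r *\<^sub>R x) = r *\<^sub>R cadjoint f x" for r x
    by (rule vector_eq_rdot[THEN iffD1])
      (simp add: inner_cadjoint'[OF f] inner_simps)
  moreover have "cadjoint f (c *\<^sub>C x) = c *\<^sub>C cadjoint f x" for c x
    by (rule vector_eq_rdot[THEN iffD1])
      (simp add: inner_cadjoint'[OF f] inner_scaleC_left bounded_clinear_scaleC[OF f])
  ultimately show ?thesis
    unfolding bounded_clinear_def by (blast intro: bounded_linear_intro)
qed

lemma norm_scaleC: "norm (c *\<^sub>C x) = cmod c * norm (x :: 'a::complex_hilbert_space)"
proof -
  have "(norm (c *\<^sub>C x))\<^sup>2 = Re (cinner (c *\<^sub>C x) (c *\<^sub>C x))"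
    by (simp add: Re_cinner power2_norm_eq_inner)
  also have "\<dots> = Re ((c * cnj c) * cinner x x)"
    by (simp only: cinner_scaleC_left cinner_scaleC_right ac_simps)
  also have "\<dots> = (cmod c * norm x)\<^sup>2"
    by (simp add: Re_cinner power_mult_distrib flip: complex_norm_square power2_norm_eq_inner
        of_real_power)
  finally show ?thesis by (simp add: power2_eq_iff_nonneg)
qed

lemma bounded_clinear_scaleC_right:
  "bounded_clinear (\<lambda>x :: 'a::complex_hilbert_space. c *\<^sub>C x)"
  unfolding bounded_clinear_def
proof (intro conjI allI bounded_linear_intro[where K = "cmod c"])
  fix r :: real and x :: 'a
  show "c *\<^sub>C r *\<^sub>R x = r *\<^sub>R c *\<^sub>C x"
    by (simp add: scaleC_scaleC mult.commute flip: scaleC_of_real)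
qed (simp_all add: scaleC_add_right norm_scaleC scaleC_scaleC mult.commute)

lemma cinner_zero_right: "cinner x 0 = 0"
  using cinner_scaleC_right[of x 0 0] by simp

lemma cinner_add_right: "cinner x (y + z) = cinner x y + cinner x z"
proof -
  have "cinner x (y + z) = cnj (cinner y x + cinner z x)"
    by (simp only: cinner_commute[of x "y + z"] cinner_add_left)
  then show ?thesis
    by (simp only: complex_cnj_add cinner_commute[of x y] cinner_commute[of x z])
qed

lemma closed_orthogonal: "closed {y. cinner x y = 0}"
proof -
  have "{y. cinner x y = 0} = (\<Inter>c. {y. inner (c *\<^sub>C x) y = 0})"
    using cinner_eqI_inner[of x _ x 0]
    by (auto simp: cinner_scaleC_left cinner_zero_right simp flip: Re_cinner)
  moreover have "closed {y. inner (c *\<^sub>C x) y = 0}" for c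
    by (intro closed_Collect_eq continuous_intros)
  ultimately show ?thesis by auto
qed

lemma subspace_orthogonal: "complex_vector.subspace {y. cinner x y = 0}"
  by (rule complex_vector.subspaceI)
    (simp_all add: cinner_zero_right cinner_add_right cinner_scaleC_right)

lemma inner_isometry:
  assumes "isometry f"
  shows "inner (f x) (f y) = inner x y"
proof -
  have f: "bounded_clinear f" and norm: "\<And>z. norm (f z) = norm z"
    using assms by (auto simp: isometry_def)
  show ?thesis by (simp add: dot_norm norm flip: bounded_clinear_add[OF f])
qed

lemma cadjoint_isometry:
  assumes "isometry f"
  shows "cadjoint f (f x) = x"
  by (rule vector_eq_rdot[THEN iffD1])
    (use assms in \<open>simp add: inner_cadjoint' inner_isometry isometry_def[of f]\<close>)

lemma cadjoint_compose:
  assumes "bounded_clinear f" "bounded_clinear g"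
  shows "cadjoint (f \<circ> g) x = cadjoint g (cadjoint f x)"
  using cadjoint_eqI[of "f \<circ> g" "\<lambda>x. cadjoint g (cadjoint f x)"] assms
  by (simp add: cinner_cadjoint)

lemma cadjoint_id: "cadjoint id x = x"
  by (subst cadjoint_eqI[of id "\<lambda>x. x"]) simp_all

section \<open>Square roots of positive operators\<close>

text \<open>Polarization: the quadratic form at \<open>x + y\<close> and \<open>x - y\<close>
  controls \<open>inner (Z x) y\<close>, and the right \<open>y\<close> turns this into a norm
  bound.\<close>

lemma symmetric_norm_le:
  fixes Z :: "'a::real_inner \<Rightarrow> 'a"
  assumes Z: "linear Z"
    and sym: "\<And>x y. inner (Z x) y = inner x (Z y)"
    and nonneg: "\<And>x. 0 \<le> inner (Z x) x"
    and le: "\<And>x. inner (Z x) x \<le> r * (norm x)\<^sup>2"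
  shows "norm (Z x) \<le> r * norm x"
proof (cases "Z x = 0 \<or> x = 0")
  case True
  have "0 \<le> r * norm x"
  proof (cases "x = 0")
    case False
    have "0 \<le> r * (norm x)\<^sup>2" using nonneg[of x] le[of x] by linarith
    then show ?thesis using False by (simp add: zero_le_mult_iff)
  qed simp
  then show ?thesis using True linear_0[OF Z] by auto
next
  case False
  \<comment> \<open>\<open>y\<close> points along \<open>Z x\<close> and has the norm of
    \<open>x\<close>, so \<open>inner (Z x) y\<close> equals
    \<open>norm x * norm (Z x)\<close>.\<close>
  define t where "t = norm x / norm (Z x)"
  define y where "y = t *\<^sub>R Z x"
  have ny: "norm y = norm x" using False by (simp add: y_def t_def)
  have "4 * inner (Z x) y = inner (Z (x + y)) (x + y) - inner (Z (x - y)) (x - y)"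
    using sym[of y x] by (simp add: linear_add[OF Z] linear_diff[OF Z] inner_simps inner_commute)
  also have "\<dots> \<le> r * (norm (x + y))\<^sup>2 + r * (norm (x - y))\<^sup>2"
  proof -
    have "0 \<le> r * (norm (x - y))\<^sup>2" using nonneg[of "x - y"] le[of "x - y"] by linarith
    then show ?thesis using nonneg[of "x - y"] le[of "x + y"] by linarith
  qed
  also have "\<dots> = r * (2 * (norm x)\<^sup>2 + 2 * (norm y)\<^sup>2)"
    by (simp add: power2_norm_eq_inner inner_simps inner_commute algebra_simps)
  finally have "inner (Z x) y \<le> r * (norm x)\<^sup>2" by (simp add: ny)
  moreover have "inner (Z x) y = norm x * norm (Z x)"
    using False by (simp add: y_def t_def dot_square_norm power2_eq_square)
  ultimately have "norm x * norm (Z x) \<le> norm x * (r * norm x)"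
    by (simp add: power2_eq_square algebra_simps)
  then show ?thesis using False by simp
qed

lemma bijective_id_minus_contraction:
  fixes Y :: "'a::banach \<Rightarrow> 'a"
  assumes Y: "linear Y" and le: "\<And>x. norm (Y x) \<le> r * norm x" and r: "r < 1"
  shows "bij (\<lambda>x. x - Y x)"
\<comment> \<open>A nonzero vector forces \<open>0 \<le> r\<close>, as the fixed point theorem
  requires; in the zero space \<open>r\<close> may be negative.\<close>
proof (cases "\<exists>x::'a. x \<noteq> 0")
  case True
  then obtain x :: 'a where "x \<noteq> 0" by blast
  then have "0 \<le> r" using le[of x] norm_ge_zero[of "Y x"] by (smt (verit) mult_neg_pos zero_less_norm_iff)
  have "\<exists>!x. x - Y x = y" for y
  proof -
    have "\<exists>!x. y + Y x = x"
      by (rule banach_fix_type[where c = r])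
        (use \<open>0 \<le> r\<close> r le in \<open>auto simp: dist_norm simp flip: linear_diff[OF Y]\<close>)
    then show ?thesis by (simp add: algebra_simps eq_commute)
  qed
  then show ?thesis by (simp add: bij_iff)
next
  case False
  then have "\<And>x y. x = (y::'a)" by metis
  then show ?thesis by (metis bijI')
qed

text \<open>
  For symmetric \<open>Z\<close> with \<open>\<parallel>Z\<parallel> < 1\<close> the root of \<open>I - Z\<close> is \<open>I - Y\<close>, where \<open>Y\<close> is the fixed point
  of \<open>Y \<mapsto> (Z + Y\<^sup>2) / 2\<close>. This map is a contraction of the closed set of symmetric operators of norm
  at most \<open>\<parallel>Z\<parallel>\<close> in the commutant of \<open>\<F>\<close>, so the root inherits these properties.
\<close>

lemma square_root_id_minus:
  fixes Z :: "'a::{real_inner,banach} \<Rightarrow>\<^sub>L 'a" and \<F> :: "('a \<Rightarrow> 'a) set"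
  assumes Z: "norm Z < 1"
    and sym: "\<And>x y. inner (Z x) y = inner x (Z y)"
    and F: "\<And>F. F \<in> \<F> \<Longrightarrow> bounded_linear F"
    and com: "\<And>F x. F \<in> \<F> \<Longrightarrow> Z (F x) = F (Z x)"
  obtains G :: "'a \<Rightarrow> 'a" where "bounded_linear G" "bij G"
    "\<And>x. G (G x) = x - Z x" "\<And>x y. inner (G x) y = inner x (G y)"
    "\<And>F x. F \<in> \<F> \<Longrightarrow> G (F x) = F (G x)"
proof -
  define r where "r = norm Z"
  define \<Omega> where "\<Omega> = {Y :: 'a \<Rightarrow>\<^sub>L 'a. norm Y \<le> r \<and>
    (\<forall>x y. inner (blinfun_apply Y x) y = inner x (blinfun_apply Y y)) \<and> (\<forall>F\<in>\<F>. \<forall>x. blinfun_apply Y (F x) = F (blinfun_apply Y x))}"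
  define \<Phi> where "\<Phi> Y = (1/2) *\<^sub>R (Z + (Y o\<^sub>L Y))" for Y :: "'a \<Rightarrow>\<^sub>L 'a"
  have r: "0 \<le> r" "r < 1" using Z by (auto simp: r_def)
  have cont: "continuous_on UNIV (\<lambda>Y :: 'a \<Rightarrow>\<^sub>L 'a. blinfun_apply Y x)" for x
    by (intro linear_continuous_on blinfun.bounded_linear_left)
  have "\<Omega> = {Y. norm Y \<le> r} \<inter>
      (\<Inter>x. \<Inter>y. {Y. inner (blinfun_apply Y x) y = inner x (blinfun_apply Y y)}) \<inter>
      (\<Inter>F\<in>\<F>. \<Inter>x. {Y. blinfun_apply Y (F x) = F (blinfun_apply Y x)})"
    by (auto simp: \<Omega>_def)
  moreover have "closed {Y :: 'a \<Rightarrow>\<^sub>L 'a. norm Y \<le> r}"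
    by (intro closed_Collect_le continuous_intros)
  moreover have "closed {Y :: 'a \<Rightarrow>\<^sub>L 'a. inner (blinfun_apply Y x) y = inner x (blinfun_apply Y y)}" for x y
    by (intro closed_Collect_eq continuous_on_inner cont continuous_on_const)
  moreover have "closed {Y :: 'a \<Rightarrow>\<^sub>L 'a. blinfun_apply Y (F x) = F (blinfun_apply Y x)}" if "F \<in> \<F>" for F x
    by (intro closed_Collect_eq cont bounded_linear.continuous_on[OF F[OF that]])
  ultimately have "closed \<Omega>"
    by (auto intro!: closed_Int closed_INT)
  then have "complete \<Omega>" by (simp add: complete_eq_closed)
  moreover have "0 \<in> \<Omega>"
    using r F by (auto simp: \<Omega>_def linear_simps)
  moreover have "\<Phi> Y \<in> \<Omega>" if "Y \<in> \<Omega>" for Y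
  proof -
    have "norm (\<Phi> Y) \<le> (1/2) * (norm Z + norm Y * norm Y)"
      unfolding \<Phi>_def
      using norm_triangle_mono[OF order_refl norm_blinfun_compose, of Z Y Y] by simp
    also have "\<dots> \<le> (1/2) * (r + r * 1)"
      using that r unfolding r_def[symmetric] \<Omega>_def
      by (intro mult_left_mono add_left_mono mult_mono) auto
    finally have "norm (\<Phi> Y) \<le> r" by simp
    then show ?thesis
      using that sym com F
      by (auto simp: \<Omega>_def \<Phi>_def blinfun.bilinear_simps inner_simps linear_simps)
  qed
  moreover have "dist (\<Phi> Y) (\<Phi> Y') \<le> r * dist Y Y'" if "Y \<in> \<Omega>" "Y' \<in> \<Omega>" for Y Y'
  proof -
    \<comment> \<open>The mixed terms cancel although \<open>Y\<close> and \<open>Y'\<close> may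
      fail to commute.\<close>
    have "\<Phi> Y - \<Phi> Y' = (1/2) *\<^sub>R ((Y o\<^sub>L (Y - Y')) + ((Y - Y') o\<^sub>L Y'))"
      unfolding \<Phi>_def by (rule blinfun_eqI) (simp add: blinfun.bilinear_simps algebra_simps)
    then have "norm (\<Phi> Y - \<Phi> Y') \<le> (1/2) * (norm Y * norm (Y - Y') + norm (Y - Y') * norm Y')"
      using norm_triangle_mono[OF norm_blinfun_compose norm_blinfun_compose, of Y "Y - Y'" "Y - Y'" Y']
      by simp
    also have "\<dots> \<le> (1/2) * (r * norm (Y - Y') + norm (Y - Y') * r)"
      using that r unfolding \<Omega>_def
      by (intro mult_left_mono add_mono mult_mono) auto
    finally show ?thesis by (simp add: dist_norm mult.commute)
  qed
  ultimately have "\<exists>!Y\<in>\<Omega>. \<Phi> Y = Y"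
    using r by (intro Banach_fix[where c = r]) auto
  then obtain Y where Y: "Y \<in> \<Omega>" "\<Phi> Y = Y" by blast
  have fix2: "2 *\<^sub>R Y x = Z x + Y (Y x)" for x
    by (subst Y(2)[symmetric]) (simp add: \<Phi>_def blinfun.bilinear_simps)
  let ?G = "\<lambda>x. x - Y x"
  show ?thesis
  proof (rule that[of ?G])
    show "bounded_linear ?G" by (intro bounded_linear_intros)
    have "norm (Y x) \<le> r * norm x" for x
      using norm_blinfun[of Y x] Y(1) mult_right_mono[of "norm Y" r "norm x"]
      by (auto simp: \<Omega>_def)
    then show "bij ?G"
      using r by (intro bijective_id_minus_contraction[where r = r])
        (auto intro: bounded_linear.linear blinfun.bounded_linear_right)
    show "?G (?G x) = x - Z x" for x
      using fix2[of x] by (simp add: blinfun.bilinear_simps scaleR_2 algebra_simps)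
    show "inner (?G x) y = inner x (?G y)" for x y
      using Y(1) by (simp add: \<Omega>_def inner_simps)
    show "?G (F x) = F (?G x)" if "F \<in> \<F>" for F x
      using Y(1) that F[OF that] by (simp add: \<Omega>_def linear_simps)
  qed
qed

section \<open>Row isometries and the Cuntz projection\<close>

lemma bounded_clinear_pointwise_limit:
  assumes F: "\<And>k. bounded_clinear (F k)"
    and le: "\<And>k x. norm (F k x) \<le> m * norm x"
    and lim: "\<And>x. (\<lambda>k. F k x) \<longlonglongrightarrow> L x"
  shows "bounded_clinear L" and "norm (L x) \<le> m * norm x"
proof -
  have bound: "norm (L x) \<le> m * norm x" for x
    by (rule LIMSEQ_le_const2[OF tendsto_norm[OF lim]]) (use le in auto)
  then show "norm (L x) \<le> m * norm x" .
  have "L (x + y) = L x + L y" for x y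
    by (rule LIMSEQ_unique[OF lim])
      (simp add: bounded_clinear_add[OF F] tendsto_add lim)
  moreover have scaleC: "L (c *\<^sub>C x) = c *\<^sub>C L x" for c x
  proof (rule LIMSEQ_unique[OF lim])
    show "(\<lambda>k. F k (c *\<^sub>C x)) \<longlonglongrightarrow> c *\<^sub>C L x"
      unfolding bounded_clinear_scaleC[OF F]
      by (rule bounded_clinear_tendsto[OF bounded_clinear_scaleC_right lim])
  qed
  moreover have "L (r *\<^sub>R x) = r *\<^sub>R L x" for r x
    using scaleC[of "complex_of_real r" x] by (simp only: scaleC_of_real)
  ultimately show "bounded_clinear L"
    using bound unfolding bounded_clinear_def
    by (auto intro!: bounded_linear_intro[where K = m] simp: mult.commute)
qed

text \<open>A three-epsilon argument with the common bound; hence convergence on a dense subspace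
  implies convergence everywhere.\<close>

lemma closed_convergent_bounded_clinear:
  fixes F :: "nat \<Rightarrow> 'a::complex_hilbert_space \<Rightarrow> 'b::complex_hilbert_space"
  assumes F: "\<And>k. bounded_clinear (F k)"
    and le: "\<And>k x. norm (F k x) \<le> m * norm x"
  shows "closed {x. convergent (\<lambda>k. F k x)}"
unfolding closed_sequential_limits
proof (intro allI impI, elim conjE)
  fix x l assume x: "\<forall>n. x n \<in> {x. convergent (\<lambda>k. F k x)}" and l: "x \<longlonglongrightarrow> l"
  have "Cauchy (\<lambda>k. F k l)"
  proof (rule metric_CauchyI)
    fix e :: real assume "e > 0"
    define M where "M = max m 1"
    have M: "norm (F k y) \<le> M * norm y" "M > 0" for k y
      using order_trans[OF le mult_right_mono[of m M "norm y"]] by (auto simp: M_def)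
    have "e / (3 * M) > 0" using \<open>e > 0\<close> M(2) by simp
    then obtain n where n: "norm (x n - l) < e / (3 * M)"
      using LIMSEQ_D[OF l] by blast
    have small: "dist (F k l) (F k (x n)) < e / 3" for k
    proof -
      have "dist (F k l) (F k (x n)) \<le> M * norm (l - x n)"
        using M(1)[of k "l - x n"] by (simp add: dist_norm bounded_clinear_diff[OF F])
      also have "\<dots> < e / 3"
        using n M(2) by (simp add: norm_minus_commute field_simps)
      finally show ?thesis .
    qed
    have "Cauchy (\<lambda>k. F k (x n))" using x convergent_Cauchy by blast
    then obtain N where N: "\<And>i j. i \<ge> N \<Longrightarrow> j \<ge> N \<Longrightarrow> dist (F i (x n)) (F j (x n)) < e / 3"
      using metric_CauchyD[of _ "e / 3"] \<open>e > 0\<close> by (metis divide_pos_pos zero_less_numeral)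
    have "dist (F i l) (F j l) < e" if "i \<ge> N" "j \<ge> N" for i j
      by (rule dist_triangle_third[OF small[of i] N[OF that] small[of j, unfolded dist_commute[of "F j l"]]])
    then show "\<exists>N. \<forall>i\<ge>N. \<forall>j\<ge>N. dist (F i l) (F j l) < e" by blast
  qed
  then show "l \<in> {x. convergent (\<lambda>k. F k x)}" by (simp add: Cauchy_convergent)
qed

lemma subspace_convergent_bounded_clinear:
  assumes F: "\<And>k. bounded_clinear (F k)"
  shows "complex_vector.subspace {x. convergent (\<lambda>k. F k x)}"
proof (rule complex_vector.subspaceI)
  fix c x assume "x \<in> {x. convergent (\<lambda>k. F k x)}"
  then obtain l where "(\<lambda>k. F k x) \<longlonglongrightarrow> l" by (auto simp: convergent_def)
  then have "(\<lambda>k. F k (c *\<^sub>C x)) \<longlonglongrightarrow> c *\<^sub>C l"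
    unfolding bounded_clinear_scaleC[OF F]
    by (rule bounded_clinear_tendsto[OF bounded_clinear_scaleC_right])
  then show "c *\<^sub>C x \<in> {x. convergent (\<lambda>k. F k x)}" by (auto simp: convergent_def)
qed (auto simp: bounded_clinear_zero[OF F] bounded_clinear_add[OF F] convergent_const intro: convergent_add)

text \<open>The \<open>k\<close>-th iterate of \<open>sandwich T S\<close> at \<open>F\<close> is
  the sum of \<open>T\<^sub>w F S\<^sub>w\<^sup>*\<close> over words \<open>w\<close> of length
  \<open>k\<close>; iterating a map on operators avoids explicit sums over words.\<close>

definition sandwich ::
    "('i::finite \<Rightarrow> 'k \<Rightarrow> 'k::complex_hilbert_space) \<Rightarrow> ('i \<Rightarrow> 'h \<Rightarrow> 'h::complex_hilbert_space) \<Rightarrow>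
     ('h \<Rightarrow> 'k) \<Rightarrow> 'h \<Rightarrow> 'k"
  where "sandwich T S F x = (\<Sum>i\<in>UNIV. T i (F (cadjoint (S i) x)))"

locale row_isometry =
  fixes S :: "'i::finite \<Rightarrow> 'h::complex_hilbert_space \<Rightarrow> 'h"
  assumes isometry: "isometry (S i)"
    and orthogonal: "i \<noteq> j \<Longrightarrow> cinner (S i x) (S j y) = 0"
begin

lemma clinear: "bounded_clinear (S i)"
  using isometry by (simp add: isometry_def)

lemma clinear_adjoint: "bounded_clinear (cadjoint (S i))"
  by (rule bounded_clinear_cadjoint[OF clinear])

lemma inner_S: "inner (S i x) (S j y) = (if i = j then inner x y else 0)"
proof (cases "i = j")
  case False
  then show ?thesis using orthogonal[of i j x y] by (metis Re_cinner zero_complex.sel(1))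
qed (simp add: inner_isometry isometry)

lemma adjoint_S: "cadjoint (S i) (S j x) = (if i = j then x else 0)"
  by (rule vector_eq_rdot[THEN iffD1]) (simp add: inner_cadjoint'[OF clinear] inner_S eq_commute)

lemma norm_sum_S: "(norm (\<Sum>i\<in>UNIV. S i (f i)))\<^sup>2 = (\<Sum>i\<in>UNIV. (norm (f i))\<^sup>2)"
  by (simp add: power2_norm_eq_inner inner_sum_left inner_sum_right inner_S)

text \<open>\<open>y\<close> is the projection of \<open>x\<close> to the sum of the ranges:
  \<open>(norm y)\<^sup>2 = inner y x\<close>, and Cauchy-Schwarz gives
  \<open>norm y \<le> norm x\<close>.\<close>

lemma bessel: "(\<Sum>i\<in>UNIV. (norm (cadjoint (S i) x))\<^sup>2) \<le> (norm x)\<^sup>2"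
proof -
  define y where "y = (\<Sum>i\<in>UNIV. S i (cadjoint (S i) x))"
  have y: "(norm y)\<^sup>2 = (\<Sum>i\<in>UNIV. (norm (cadjoint (S i) x))\<^sup>2)"
    unfolding y_def by (rule norm_sum_S)
  also have "\<dots> = inner y x"
    by (simp add: y_def inner_sum_left inner_cadjoint[OF clinear] power2_norm_eq_inner)
  also have "\<dots> \<le> norm y * norm x" by (rule norm_cauchy_schwarz)
  finally have "norm y \<le> norm x" by (cases "y = 0") (simp_all add: power2_eq_square)
  then show ?thesis using y by (metis norm_ge_zero power_mono)
qed

end

locale row_isometry_pair = S: row_isometry S + T: row_isometry T
  for S :: "'i::finite \<Rightarrow> 'h::complex_hilbert_space \<Rightarrow> 'h"
    and T :: "'i \<Rightarrow> 'k::complex_hilbert_space \<Rightarrow> 'k"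
begin

text \<open>The summands are orthogonal and Bessel's inequality bounds the vectors
  \<open>cadjoint (S i) x\<close>, so averaging does not enlarge a bound, however often it is
  iterated.\<close>

lemma norm_sandwich_le:
  assumes F: "\<And>x. norm (F x) \<le> m * norm x" and m: "0 \<le> m"
  shows "norm (sandwich T S F x) \<le> m * norm x"
proof (rule power2_le_imp_le)
  have "(norm (sandwich T S F x))\<^sup>2 = (\<Sum>i\<in>UNIV. (norm (F (cadjoint (S i) x)))\<^sup>2)"
    unfolding sandwich_def by (rule T.norm_sum_S)
  also have "\<dots> \<le> (\<Sum>i\<in>UNIV. (m * norm (cadjoint (S i) x))\<^sup>2)"
    by (intro sum_mono power_mono F) simp
  also have "\<dots> = m\<^sup>2 * (\<Sum>i\<in>UNIV. (norm (cadjoint (S i) x))\<^sup>2)"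
    by (simp add: power_mult_distrib sum_distrib_left)
  also have "\<dots> \<le> m\<^sup>2 * (norm x)\<^sup>2" by (intro mult_left_mono S.bessel) simp
  finally show "(norm (sandwich T S F x))\<^sup>2 \<le> (m * norm x)\<^sup>2"
    by (simp add: power_mult_distrib)
qed (use m in simp)

lemma bounded_clinear_sandwich:
  assumes "bounded_clinear F"
  shows "bounded_clinear (sandwich T S F)"
  unfolding sandwich_def[abs_def]
  by (intro bounded_clinear_sumI bounded_clinear_compose[OF T.clinear]
      bounded_clinear_compose[OF assms] S.clinear_adjoint)

text \<open>Only the summand with index \<open>i\<close> survives. With
  \<open>adjoint_sandwich\<close>, this makes a fixed point of the averaging intertwine both the
  isometries and their adjoints.\<close>

lemma sandwich_S:
  assumes "bounded_clinear F"
  shows "sandwich T S F (S i x) = T i (F x)"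
proof -
  have "T j (F (cadjoint (S j) (S i x))) = (if j = i then T i (F x) else 0)" for j
    by (simp add: S.adjoint_S bounded_clinear_zero[OF assms] bounded_clinear_zero[OF T.clinear])
  then show ?thesis by (simp add: sandwich_def)
qed

lemma adjoint_sandwich: "cadjoint (T i) (sandwich T S F x) = F (cadjoint (S i) x)"
  by (simp add: sandwich_def bounded_clinear_sum[OF T.clinear_adjoint] T.adjoint_S)

lemma bounded_clinear_sandwich_power:
  "bounded_clinear F \<Longrightarrow> bounded_clinear ((sandwich T S ^^ k) F)"
  by (induction k) (simp_all add: bounded_clinear_sandwich)

lemma norm_sandwich_power_le:
  assumes "\<And>x. norm (F x) \<le> m * norm x" and "0 \<le> m"
  shows "norm ((sandwich T S ^^ k) F x) \<le> m * norm x"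
  by (induction k arbitrary: x) (simp_all add: assms norm_sandwich_le)

end

text \<open>Introduced as a strong limit, so that no projection onto a closed subspace has to be
  constructed first; \<open>convergent_range_projection\<close> makes \<open>lim\<close>
  meaningful.\<close>

definition cuntz_projection ::
    "('i::finite \<Rightarrow> 'h::complex_hilbert_space \<Rightarrow> 'h) \<Rightarrow> 'h \<Rightarrow> 'h"
  where "cuntz_projection S x = lim (\<lambda>k. (sandwich S S ^^ k) (\<lambda>x. x) x)"

context row_isometry
begin

sublocale self: row_isometry_pair S S ..

text \<open>\<open>range_projection k\<close> is \<open>\<Sum>\<^bsub>|w| = k\<^esub> S\<^sub>w S\<^sub>w\<^sup>*\<close>; it decreases strongly to the projection onto the Cuntz space.\<close>

abbreviation range_projection :: "nat \<Rightarrow> 'h \<Rightarrow> 'h"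
  where "range_projection k \<equiv> (sandwich S S ^^ k) (\<lambda>x. x)"

lemma bounded_clinear_range_projection: "bounded_clinear (range_projection k)"
  by (rule self.bounded_clinear_sandwich_power[OF bounded_clinear_ident])

lemma norm_range_projection_le: "norm (range_projection k x) \<le> 1 * norm x"
  by (rule self.norm_sandwich_power_le) simp_all

lemma range_projection_Suc:
  "range_projection (Suc k) x = (\<Sum>i\<in>UNIV. S i (range_projection k (cadjoint (S i) x)))"
  by (simp add: sandwich_def)

lemma range_projection_symmetric:
  "inner (range_projection k x) y = inner x (range_projection k y)"
proof (induction k arbitrary: x y)
  case (Suc k)
  then show ?case
    by (simp add: sandwich_def inner_sum_left inner_sum_right inner_cadjoint[OF clinear]
        inner_cadjoint'[OF clinear, symmetric])
qed simp

text \<open>The ranges are nested: each \<open>cadjoint (S i)\<close> strips one letter, which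
  reduces the claim to the lengths \<open>k\<close> and \<open>l'\<close>. The case
  \<open>k = l\<close> is idempotence.\<close>

lemma range_projection_absorb:
  "k \<le> l \<Longrightarrow> range_projection k (range_projection l x) = range_projection l x"
proof (induction k arbitrary: l x)
  case (Suc k)
  then obtain l' where l: "l = Suc l'" "k \<le> l'" by (cases l) auto
  have "range_projection (Suc k) (range_projection l x) =
      (\<Sum>i\<in>UNIV. S i (range_projection k (cadjoint (S i) (range_projection l x))))"
    by (rule range_projection_Suc)
  also have "\<dots> = (\<Sum>i\<in>UNIV. S i (range_projection k (range_projection l' (cadjoint (S i) x))))"
    by (simp add: l self.adjoint_sandwich)
  also have "\<dots> = range_projection l x"
    by (simp only: Suc.IH[OF l(2)] l(1) range_projection_Suc)
  finally show ?case .
qed simp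

text \<open>For \<open>k \<le> l\<close>, nesting and symmetry give the Pythagorean identity
  \<open>eq\<close>; the squared norms decrease and are nonnegative, so they are Cauchy, and with
  them the vectors.\<close>

lemma convergent_range_projection: "convergent (\<lambda>k. range_projection k x)"
proof -
  define a where "a k = (norm (range_projection k x))\<^sup>2" for k
  have eq: "(norm (range_projection k x - range_projection l x))\<^sup>2 = a k - a l"
    if "k \<le> l" for k l
  proof -
    have "inner (range_projection k x) (range_projection l x) =
        inner x (range_projection l (range_projection l x))"
      by (simp add: range_projection_symmetric range_projection_absorb that)
    also have "\<dots> = a l"
      by (simp only: a_def power2_norm_eq_inner range_projection_symmetric)
    finally show ?thesis
      by (simp add: a_def power2_norm_eq_inner inner_simps inner_commute)
  qed
  have "decseq a"
    unfolding decseq_def using eq by (metis diff_ge_0_iff_ge zero_le_power2)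
  moreover have "0 \<le> a k" for k by (simp add: a_def)
  ultimately have "Cauchy a"
    by (metis decseq_convergent LIMSEQ_imp_Cauchy)
  have "Cauchy (\<lambda>k. range_projection k x)"
  proof (rule CauchyI')
    fix e :: real assume "e > 0"
    then obtain N where N: "\<And>k l. k \<ge> N \<Longrightarrow> l \<ge> N \<Longrightarrow> norm (a k - a l) < e\<^sup>2"
      using CauchyD[OF \<open>Cauchy a\<close>, of "e\<^sup>2"] by auto
    have "norm (range_projection k x - range_projection l x) < e" if "k \<ge> N" "l > k" for k l
    proof -
      have "(norm (range_projection k x - range_projection l x))\<^sup>2 < e\<^sup>2"
        using eq[of k l] N[of k l] that by simp
      then show ?thesis using \<open>e > 0\<close> by (simp add: power2_less_imp_less)
    qed
    then show "\<exists>N. \<forall>k\<ge>N. \<forall>l>k. dist (range_projection k x) (range_projection l x) < e"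
      by (auto simp: dist_norm)
  qed
  then show ?thesis by (simp add: Cauchy_convergent)
qed

lemma tendsto_cuntz_projection: "(\<lambda>k. range_projection k x) \<longlonglongrightarrow> cuntz_projection S x"
  using convergent_range_projection by (simp add: cuntz_projection_def convergent_LIMSEQ_iff)

lemma bounded_clinear_cuntz_projection: "bounded_clinear (cuntz_projection S)"
  by (rule bounded_clinear_pointwise_limit[OF bounded_clinear_range_projection
        norm_range_projection_le tendsto_cuntz_projection])

lemma norm_cuntz_projection_le: "norm (cuntz_projection S x) \<le> norm x"
  using bounded_clinear_pointwise_limit(2)[OF bounded_clinear_range_projection
      norm_range_projection_le tendsto_cuntz_projection] by simp

lemma cuntz_projection_symmetric:
  "inner (cuntz_projection S x) y = inner x (cuntz_projection S y)"
proof (rule LIMSEQ_unique)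
  show "(\<lambda>k. inner (range_projection k x) y) \<longlonglongrightarrow> inner (cuntz_projection S x) y"
    by (intro tendsto_intros tendsto_cuntz_projection)
  show "(\<lambda>k. inner (range_projection k x) y) \<longlonglongrightarrow> inner x (cuntz_projection S y)"
    unfolding range_projection_symmetric by (intro tendsto_intros tendsto_cuntz_projection)
qed

lemma cinner_cuntz_projection:
  "cinner (cuntz_projection S x) y = cinner x (cuntz_projection S y)"
  by (rule cinner_eqI_inner)
    (simp add: cuntz_projection_symmetric
      flip: bounded_clinear_scaleC[OF bounded_clinear_cuntz_projection])

text \<open>\<open>range_projection (Suc k)\<close> after \<open>S i\<close> is \<open>S i\<close>
  after \<open>range_projection k\<close>; the index shift disappears in the limit.\<close>

lemma cuntz_projection_S: "cuntz_projection S (S i x) = S i (cuntz_projection S x)"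
proof (rule LIMSEQ_unique)
  show "(\<lambda>k. range_projection (Suc k) (S i x)) \<longlonglongrightarrow> cuntz_projection S (S i x)"
    by (rule LIMSEQ_Suc[OF tendsto_cuntz_projection])
  show "(\<lambda>k. range_projection (Suc k) (S i x)) \<longlonglongrightarrow> S i (cuntz_projection S x)"
    by (simp add: self.sandwich_S bounded_clinear_range_projection
        bounded_clinear_tendsto[OF clinear tendsto_cuntz_projection])
qed

lemma range_projection_eq_imp_cuntz_projection_eq:
  assumes "\<And>k. range_projection k x = x"
  shows "cuntz_projection S x = x"
  using tendsto_cuntz_projection[of x] by (simp add: assms LIMSEQ_const_iff)

lemma cuntz_projection_idem: "cuntz_projection S (cuntz_projection S x) = cuntz_projection S x"
proof (rule range_projection_eq_imp_cuntz_projection_eq)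
  fix k
  have "(\<lambda>l. range_projection k (range_projection l x)) \<longlonglongrightarrow> range_projection k (cuntz_projection S x)"
    by (rule bounded_clinear_tendsto[OF bounded_clinear_range_projection tendsto_cuntz_projection])
  moreover have "(\<lambda>l. range_projection k (range_projection l x)) \<longlonglongrightarrow> cuntz_projection S x"
    by (rule Lim_transform_eventually[OF tendsto_cuntz_projection])
      (auto simp: eventually_sequentially range_projection_absorb intro!: exI[of _ k])
  ultimately show "range_projection k (cuntz_projection S x) = cuntz_projection S x"
    by (rule LIMSEQ_unique)
qed

text \<open>Every \<open>cadjoint (S i)\<close> kills a wandering vector, so all range projections
  of positive index vanish on it; index 0 is the identity, hence the passage to
  \<open>Suc k\<close>.\<close>

lemma cuntz_projection_wandering_space:
  assumes "x \<in> wandering_space S"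
  shows "cuntz_projection S x = 0"
proof -
  obtain y where x: "x = y - sandwich S S (\<lambda>x. x) y"
    using assms by (auto simp: wandering_space_def sandwich_def)
  have "cadjoint (S i) x = 0" for i
    unfolding x by (simp add: bounded_clinear_diff[OF clinear_adjoint] self.adjoint_sandwich)
  then have "range_projection (Suc k) x = 0" for k
    by (simp add: sandwich_def bounded_clinear_zero[OF clinear]
        bounded_clinear_zero[OF bounded_clinear_range_projection])
  then show ?thesis
    using LIMSEQ_Suc[OF tendsto_cuntz_projection[of x]] by (simp add: LIMSEQ_const_iff)
qed

lemma cuntz_projection_word_op:
  "cuntz_projection S (word_op S w x) = word_op S w (cuntz_projection S x)"
  by (induction w) (simp_all add: word_op_def cuntz_projection_S)

lemma word_op_zero: "word_op S w 0 = 0"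
  by (induction w) (simp_all add: word_op_def bounded_clinear_zero[OF clinear])

lemma cuntz_space_iff:
  "x \<in> cuntz_space S \<longleftrightarrow> (\<forall>w. \<forall>y \<in> wandering_space S. cinner x (word_op S w y) = 0)"
proof
  assume "x \<in> cuntz_space S"
  moreover have "(\<Union>w. word_op S w ` wandering_space S) \<subseteq> pure_space S"
    unfolding pure_space_def
    by (rule order_trans[OF complex_vector.span_superset closure_subset])
  ultimately show "\<forall>w. \<forall>y \<in> wandering_space S. cinner x (word_op S w y) = 0"
    unfolding cuntz_space_def orthogonal_complement_def by fast
next
  assume x: "\<forall>w. \<forall>y \<in> wandering_space S. cinner x (word_op S w y) = 0"
  have "complex_vector.span (\<Union>w. word_op S w ` wandering_space S) \<subseteq> {y. cinner x y = 0}"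
    by (rule complex_vector.span_minimal[OF _ subspace_orthogonal]) (use x in blast)
  then have "pure_space S \<subseteq> {y. cinner x y = 0}"
    unfolding pure_space_def by (rule closure_minimal[OF _ closed_orthogonal])
  then show "x \<in> cuntz_space S"
    by (auto simp: cuntz_space_def orthogonal_complement_def)
qed

text \<open>The Cuntz space is invariant under each \<open>cadjoint (S i)\<close>, since an adjoint
  only prepends a letter to the word tested; so every range projection fixes its vectors.
  Conversely, the symmetric Cuntz projection kills the generators of the pure space.\<close>

lemma cuntz_space_eq: "cuntz_space S = {x. cuntz_projection S x = x}"
proof (intro equalityI subsetI CollectI)
  fix x assume "x \<in> cuntz_space S"
  then have "range_projection k x = x" for k
  proof (induction k arbitrary: x)
    case (Suc k)
    have "cadjoint (S i) x \<in> cuntz_space S" for i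
      unfolding cuntz_space_iff
    proof (intro allI ballI)
      fix w y assume "y \<in> wandering_space S"
      have "cinner (cadjoint (S i) x) (word_op S w y) = cnj (cinner (word_op S w y) (cadjoint (S i) x))"
        by (rule cinner_commute)
      also have "\<dots> = cnj (cinner (word_op S (i # w) y) x)"
        by (simp add: cinner_cadjoint[OF clinear] word_op_def)
      also have "\<dots> = cinner x (word_op S (i # w) y)"
        by (rule cinner_commute[symmetric])
      finally show "cinner (cadjoint (S i) x) (word_op S w y) = 0"
        using Suc.prems \<open>y \<in> wandering_space S\<close> by (simp add: cuntz_space_iff)
    qed
    then have "range_projection (Suc k) x = (\<Sum>i\<in>UNIV. S i (cadjoint (S i) x))"
      by (simp only: range_projection_Suc Suc.IH)
    also have "\<dots> = sandwich S S (\<lambda>x. x) x"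
      by (simp only: sandwich_def)
    also have "\<dots> = x"
    proof -
      \<comment> \<open>\<open>?y\<close> is a wandering vector, so the empty word makes
        \<open>x\<close> orthogonal to it; the projected part of \<open>x\<close> is orthogonal to
        \<open>?y\<close> as well, and their difference \<open>?y\<close> vanishes.\<close>
      let ?y = "x - sandwich S S (\<lambda>x. x) x"
      have "?y \<in> wandering_space S" by (simp add: wandering_space_def sandwich_def)
      then have "cinner x ?y = 0"
        using Suc.prems[unfolded cuntz_space_iff, THEN spec, of "[]"] by (simp add: word_op_def)
      then have "inner x ?y = 0" by (metis Re_cinner zero_complex.sel(1))
      moreover have "inner (sandwich S S (\<lambda>x. x) x) ?y = 0"
        using range_projection_symmetric[of 1 x ?y] range_projection_absorb[of 1 1 x]
        by (simp add: bounded_clinear_diff[OF self.bounded_clinear_sandwich[OF bounded_clinear_ident]])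
      ultimately have "inner ?y ?y = 0" by (simp add: inner_diff_left)
      then show ?thesis by simp
    qed
    finally show ?case .
  qed simp
  then show "cuntz_projection S x = x"
    by (rule range_projection_eq_imp_cuntz_projection_eq)
next
  fix x assume "x \<in> {x. cuntz_projection S x = x}"
  then have x: "cuntz_projection S x = x" by simp
  show "x \<in> cuntz_space S"
    unfolding cuntz_space_iff
  proof (intro allI ballI)
    fix w y assume "y \<in> wandering_space S"
    then have "cuntz_projection S (word_op S w y) = 0"
      by (simp add: cuntz_projection_word_op cuntz_projection_wandering_space word_op_zero)
    then show "cinner x (word_op S w y) = 0"
      using cinner_cuntz_projection[of x "word_op S w y"] by (simp add: x cinner_zero_right)
  qed
qed

end

section \<open>Intertwiners of row isometries\<close>

context row_isometry_pair
begin

context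
  fixes X :: "'h \<Rightarrow> 'k"
  assumes X: "bounded_clinear X" and fixed: "\<And>x. sandwich T S X x = X x"
begin

lemma fixed_S: "X (S i x) = T i (X x)"
  using sandwich_S[OF X, of i x] by (simp add: fixed)

lemma fixed_adjoint: "cadjoint (T i) (X x) = X (cadjoint (S i) x)"
  using adjoint_sandwich[of i X x] by (simp add: fixed)

text \<open>Moving \<open>X\<close> past each \<open>cadjoint (T i)\<close> turns the projection
  back into the averaging of \<open>X\<close>. In the limit, \<open>X\<close> maps into the Cuntz
  space of \<open>T\<close>; the next lemma likewise makes \<open>X\<close> factor through the Cuntz
  projection of \<open>S\<close>.\<close>

lemma range_projection_fixed: "T.range_projection k (X x) = X x"
proof (induction k arbitrary: x)
  case (Suc k)
  have "T.range_projection (Suc k) (X x) = sandwich T S X x"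
    by (simp only: T.range_projection_Suc fixed_adjoint Suc.IH) (simp only: sandwich_def)
  then show ?case by (simp only: fixed)
qed simp

lemma fixed_range_projection: "X (S.range_projection k x) = X x"
proof (induction k arbitrary: x)
  case (Suc k)
  have "X (S.range_projection (Suc k) x) = sandwich T S X x"
    by (simp only: S.range_projection_Suc bounded_clinear_sum[OF X] fixed_S Suc.IH)
      (simp only: sandwich_def)
  then show ?case by (simp only: fixed)
qed simp

lemma cuntz_projection_fixed: "cuntz_projection T (X x) = X x"
  by (rule T.range_projection_eq_imp_cuntz_projection_eq) (rule range_projection_fixed)

lemma fixed_cuntz_projection: "X (cuntz_projection S x) = X x"
  using bounded_clinear_tendsto[OF X S.tendsto_cuntz_projection[of x]]
  by (simp add: fixed_range_projection LIMSEQ_const_iff)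

text \<open>The adjoint of \<open>fixed_adjoint\<close>. With \<open>fixed_S\<close> it makes
  \<open>cadjoint X \<circ> X\<close> commute with every \<open>S i\<close>.\<close>

lemma cadjoint_fixed_T: "cadjoint X (T i y) = S i (cadjoint X y)"
proof (rule vector_eq_ldot[THEN iffD1], rule allI)
  fix z
  have "inner z (cadjoint X (T i y)) = inner (cadjoint (T i) (X z)) y"
    by (simp add: inner_cadjoint'[OF T.clinear] flip: inner_cadjoint[OF X])
  also have "\<dots> = inner z (S i (cadjoint X y))"
    by (simp add: fixed_adjoint inner_cadjoint[OF X] inner_cadjoint'[OF S.clinear])
  finally show "inner z (cadjoint X (T i y)) = inner z (S i (cadjoint X y))" .
qed

lemma cuntz_projection_cadjoint_fixed: "cuntz_projection S (cadjoint X y) = cadjoint X y"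
  by (rule vector_eq_rdot[THEN iffD1])
    (simp add: fixed_cuntz_projection S.cuntz_projection_symmetric inner_cadjoint'[OF X])

text \<open>Polar decomposition. To have an invertible root on the whole space,
  \<open>cadjoint X \<circ> X\<close> is scaled and completed by the identity on the pure space;
  \<open>I - Z\<close> is the result, \<open>G\<close> its root, and \<open>X \<circ> inv G\<close>
  up to scale restricts to the unitary.\<close>

lemma unitarily_equivalent_cuntz_part:
  assumes Y: "bounded_clinear Y"
    and YX: "\<And>x. Y (X x) = cuntz_projection S x" and XY: "\<And>y. X (Y y) = cuntz_projection T y"
  shows "unitarily_equivalent (cuntz_part S) (cuntz_part T)"
proof -
  let ?P = "cuntz_projection S"
  note P = S.bounded_clinear_cuntz_projection
  note X' = bounded_clinear_cadjoint[OF X]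
  obtain m where m: "m > 0" "\<And>x. norm (X x) \<le> norm x * m"
    using bounded_linear.pos_bounded[OF bounded_clinear_imp_bounded_linear[OF X]] by blast
  obtain n where n: "n > 0" "\<And>x. norm (Y x) \<le> norm x * n"
    using bounded_linear.pos_bounded[OF bounded_clinear_imp_bounded_linear[OF Y]] by blast
  \<comment> \<open>This scale gives
    \<open>c * (norm (X x))\<^sup>2 \<le> (norm (?P x))\<^sup>2\<close>, so the form of
    \<open>Z\<close> is nonnegative.\<close>
  define c where "c = 1 / m\<^sup>2"
  \<comment> \<open>\<open>Y\<close> bounds \<open>X\<close> from below on the Cuntz space, so
    \<open>Z\<close> is at most \<open>1 - c / n\<^sup>2\<close> times the projection. The maximum
    covers a zero Cuntz space, where this number may be negative.\<close>
  define r where "r = max 0 (1 - c / n\<^sup>2)"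
  have c: "c > 0" using m(1) by (simp add: c_def)
  have r: "0 \<le> r" "r < 1" using c n(1) by (auto simp: r_def)
  define Z where "Z x = ?P x - c *\<^sub>R cadjoint X (X x)" for x
  have Z: "bounded_linear Z"
    unfolding Z_def[abs_def]
    by (intro bounded_linear_sub bounded_linear_const_scaleR
        bounded_clinear_imp_bounded_linear P bounded_clinear_compose[OF X' X])
  have Z_sym: "inner (Z x) y = inner x (Z y)" for x y
    by (simp add: Z_def inner_simps S.cuntz_projection_symmetric inner_cadjoint'[OF X]
        flip: inner_cadjoint[OF X])
  have "inner (?P x) x = (norm (?P x))\<^sup>2" for x
    using S.cuntz_projection_symmetric[of "?P x" x]
    by (simp add: S.cuntz_projection_idem power2_norm_eq_inner)
  then have Z_form: "inner (Z x) x = (norm (?P x))\<^sup>2 - c * (norm (X x))\<^sup>2" for x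
    by (simp add: Z_def inner_simps inner_cadjoint'[OF X] power2_norm_eq_inner)
  have "norm (Z x) \<le> r * norm x" for x
  proof (rule symmetric_norm_le)
    show "linear Z" using Z by (rule bounded_linear.linear)
    fix x
    have "norm (X x) \<le> norm (?P x) * m"
      using m(2)[of "?P x"] by (simp add: fixed_cuntz_projection)
    then have "(norm (X x))\<^sup>2 \<le> (norm (?P x))\<^sup>2 * m\<^sup>2"
      by (metis norm_ge_zero power_mono power_mult_distrib)
    then show "0 \<le> inner (Z x) x"
      using m(1) by (simp add: Z_form c_def field_simps)
    have "norm (?P x) \<le> norm (X x) * n"
      using n(2)[of "X x"] by (simp add: YX)
    then have "(norm (?P x))\<^sup>2 \<le> (norm (X x))\<^sup>2 * n\<^sup>2"
      by (metis norm_ge_zero power_mono power_mult_distrib)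
    then have "(norm (?P x))\<^sup>2 / n\<^sup>2 \<le> (norm (X x))\<^sup>2"
      using n(1) by (simp add: field_simps)
    then have "c * ((norm (?P x))\<^sup>2 / n\<^sup>2) \<le> c * (norm (X x))\<^sup>2"
      using c by (intro mult_left_mono) auto
    then have "inner (Z x) x \<le> (1 - c / n\<^sup>2) * (norm (?P x))\<^sup>2"
      by (simp add: Z_form algebra_simps)
    also have "\<dots> \<le> r * (norm x)\<^sup>2"
      by (intro mult_mono power_mono S.norm_cuntz_projection_le) (auto simp: r_def)
    finally show "inner (Z x) x \<le> r * (norm x)\<^sup>2" .
  qed (rule Z_sym)
  then have "norm (Blinfun Z) \<le> r"
    by (intro norm_blinfun_bound r(1)) (simp add: bounded_linear_Blinfun_apply[OF Z])
  then have norm_Z: "norm (Blinfun Z) < 1" using r(2) by simp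
  have Z_P: "Z (?P x) = ?P (Z x)" for x
    by (simp add: Z_def fixed_cuntz_projection bounded_clinear_diff[OF P]
        cuntz_projection_cadjoint_fixed S.cuntz_projection_idem
        linear_simps(5)[OF bounded_clinear_imp_bounded_linear[OF P]])
  have Z_S: "Z (S i x) = S i (Z x)" for i x
    by (simp add: Z_def S.cuntz_projection_S fixed_S cadjoint_fixed_T
        bounded_clinear_diff[OF S.clinear]
        linear_simps(5)[OF bounded_clinear_imp_bounded_linear[OF S.clinear]])
  have Z_scaleC: "Z (d *\<^sub>C x) = d *\<^sub>C Z x" for d x
    by (simp add: Z_def bounded_clinear_scaleC[OF P] bounded_clinear_scaleC[OF X]
        bounded_clinear_scaleC[OF X'] bounded_clinear_diff[OF bounded_clinear_scaleC_right]
        linear_simps(5)[OF bounded_clinear_imp_bounded_linear[OF bounded_clinear_scaleC_right]])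
  \<comment> \<open>Commuting with the \<open>S i\<close> will give the intertwining, with
    \<open>?P\<close> the invariance of the Cuntz space, and with complex scalars the complex
    linearity, as the root is built over the reals.\<close>
  define \<F> where "\<F> = range S \<union> {?P} \<union> range (\<lambda>d x. d *\<^sub>C x)"
  obtain G where G: "bounded_linear G" "bij G" "\<And>x. G (G x) = x - Z x"
      and G_sym: "\<And>x y. inner (G x) y = inner x (G y)"
      and G_com: "\<And>F x. F \<in> \<F> \<Longrightarrow> G (F x) = F (G x)"
    using square_root_id_minus[of "Blinfun Z" \<F>] norm_Z Z_sym Z_P Z_S Z_scaleC P S.clinear
      bounded_clinear_scaleC_right bounded_clinear_imp_bounded_linear
    unfolding bounded_linear_Blinfun_apply[OF Z] \<F>_def
    by (smt (verit) Un_iff imageE singletonD)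
  have G_S: "G (S i x) = S i (G x)" and G_P: "G (?P x) = ?P (G x)"
    and G_scaleC: "G (d *\<^sub>C x) = d *\<^sub>C G x" for i x d
    using G_com unfolding \<F>_def by blast+
  define H where "H = inv G"
  have GH: "G (H x) = x" and HG: "H (G x) = x" for x
    using G(2) by (auto simp: H_def bij_is_surj surj_f_inv_f bij_is_inj)
  have H_add: "H (x + y) = H x + H y" for x y
    by (metis GH HG linear_simps(1)[OF G(1)])
  have H_scaleC: "H (d *\<^sub>C x) = d *\<^sub>C H x" for d x
    by (metis GH HG G_scaleC)
  have H_S: "H (S i x) = S i (H x)" for i x
    by (metis GH HG G_S)
  have H_P: "H (?P x) = ?P (H x)" for x
    by (metis GH HG G_P)
  \<comment> \<open>\<open>1 / m\<close> is the square root of \<open>c\<close>.\<close>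
  define U where "U x = (1 / m) *\<^sub>R X (H x)" for x
  have U_add: "U (x + y) = U x + U y" for x y
    by (simp add: U_def H_add bounded_clinear_add[OF X] scaleR_add_right)
  have U_scaleC: "U (d *\<^sub>C x) = d *\<^sub>C U x" for d x
    by (simp add: U_def H_scaleC bounded_clinear_scaleC[OF X]
        linear_simps(5)[OF bounded_clinear_imp_bounded_linear[OF bounded_clinear_scaleC_right]])
  have U_S: "U (S i x) = T i (U x)" for i x
    by (simp add: U_def H_S fixed_S
        linear_simps(5)[OF bounded_clinear_imp_bounded_linear[OF T.clinear]])
  have U_inner: "inner (U x) (U y) = inner x y" if "?P x = x" for x y
  proof -
    have "?P (H x) = H x" using H_P[of x] that by simp
    \<comment> \<open>On the Cuntz space the scaled \<open>cadjoint X \<circ> X\<close> is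
      \<open>G \<circ> G\<close>; by symmetry of \<open>G\<close>, one factor cancels each
      \<open>H\<close>.\<close>
    then have "c *\<^sub>R cadjoint X (X (H x)) = G (G (H x))"
      by (simp add: G(3) Z_def)
    moreover have "inner (U x) (U y) = inner (c *\<^sub>R cadjoint X (X (H x))) (H y)"
      by (simp add: U_def c_def inner_cadjoint'[OF X] power2_eq_square)
    ultimately show ?thesis by (simp add: G_sym GH)
  qed
  have U_cinner: "cinner (U x) (U y) = cinner x y" if "?P x = x" for x y
    by (rule cinner_eqI_inner)
      (use that in \<open>simp add: U_inner bounded_clinear_scaleC[OF P] flip: U_scaleC\<close>)
  have U_range: "cuntz_projection T (U x) = U x" for x
    by (simp add: U_def cuntz_projection_fixed
        linear_simps(5)[OF bounded_clinear_imp_bounded_linear[OF T.bounded_clinear_cuntz_projection]])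
  have "bij_betw U (cuntz_space S) (cuntz_space T)"
  proof (rule bij_betwI')
    fix x y assume "x \<in> cuntz_space S" "y \<in> cuntz_space S"
    then have xy: "?P (x - y) = x - y"
      by (simp add: S.cuntz_space_eq bounded_clinear_diff[OF P])
    show "U x = U y \<longleftrightarrow> x = y"
    proof
      assume "U x = U y"
      then have "U (x - y) = 0" using U_add[of "x - y" y] by simp
      then show "x = y" using U_inner[OF xy, of "x - y"] by simp
    qed simp
  next
    show "U x \<in> cuntz_space T" for x by (simp add: T.cuntz_space_eq U_range)
  next
    fix y assume "y \<in> cuntz_space T"
    then have y: "cuntz_projection T y = y" by (simp add: T.cuntz_space_eq)
    \<comment> \<open>\<open>H\<close> cancels \<open>G\<close>, the factor \<open>m\<close> cancels
      \<open>1 / m\<close>, and \<open>X \<circ> Y\<close> is the projection, which fixes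
      \<open>y\<close>; hence \<open>U x = y\<close>.\<close>
    define x where "x = G (m *\<^sub>R Y y)"
    have "?P (Y y) = Y y" using YX[of "Y y"] by (simp add: XY y)
    then have "?P x = x"
      by (simp add: x_def linear_simps(5)[OF bounded_clinear_imp_bounded_linear[OF P]]
          flip: G_P)
    moreover have "U x = y"
      using m(1) by (simp add: U_def x_def HG XY y
          linear_simps(5)[OF bounded_clinear_imp_bounded_linear[OF X]])
    ultimately show "\<exists>x\<in>cuntz_space S. y = U x" by (auto simp: S.cuntz_space_eq)
  qed
  then have "unitary_between U (cuntz_space S) (cuntz_space T)"
    by (simp add: unitary_between_def U_add U_scaleC U_cinner S.cuntz_space_eq)
  then show ?thesis
    by (auto simp: cuntz_part_def U_S T.cuntz_space_eq U_range intro!: exI[of _ U])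
qed

end

end

section \<open>Minimal isometric dilations\<close>

lemma minimal_isometric_dilation_row_isometry:
  "minimal_isometric_dilation A J S \<Longrightarrow> row_isometry S"
  by (simp add: minimal_isometric_dilation_def row_isometry_def)

text \<open>Minimality as an induction rule: \<open>C\<close> contains every
  \<open>word_op S w (J v)\<close>, and their closed span is the whole space.\<close>

lemma minimal_isometric_dilation_induct:
  assumes dil: "minimal_isometric_dilation A J S"
    and C: "closed C" "complex_vector.subspace C"
    and J: "\<And>v. J v \<in> C" and S: "\<And>i x. x \<in> C \<Longrightarrow> S i x \<in> C"
  shows "x \<in> C"
proof -
  have "word_op S w (J v) \<in> C" for w v
    by (induction w) (simp_all add: word_op_def J S)
  then have "closure (complex_vector.span (\<Union>w. word_op S w ` range J)) \<subseteq> C"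
    by (intro closure_minimal complex_vector.span_minimal C) auto
  then show ?thesis using dil by (auto simp: minimal_isometric_dilation_def)
qed

context row_isometry_pair
begin

text \<open>On the range of \<open>J\<close> the averages are
  \<open>T.range_projection k (K (M v))\<close>, which converge. Convergence passes along each
  \<open>S i\<close> with an index shift, and to the whole space by minimality and the common bound.
  The limit is fixed because averaging only shifts \<open>k\<close>.\<close>

lemma exists_dilation_intertwiner:
  assumes dilS: "minimal_isometric_dilation A J S" and dilT: "minimal_isometric_dilation B K T"
    and M: "bounded_clinear M" and inter: "\<And>i v. M (cadjoint (A i) v) = cadjoint (B i) (M v)"
  obtains X where "bounded_clinear X" "\<And>x. sandwich T S X x = X x"
    "\<And>v. X (J v) = cuntz_projection T (K (M v))"
proof -
  have J: "isometry J" "\<And>i v. cadjoint (S i) (J v) = J (cadjoint (A i) v)"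
    and K: "isometry K" "\<And>i v. cadjoint (T i) (K v) = K (cadjoint (B i) v)"
    using dilS dilT by (simp_all add: minimal_isometric_dilation_def)
  define F where "F k = (sandwich T S ^^ k) (\<lambda>x. K (M (cadjoint J x)))" for k
  have J': "bounded_clinear J" and K': "bounded_clinear K"
    using J(1) K(1) by (simp_all add: isometry_def)
  have "bounded_clinear (\<lambda>x. K (M (cadjoint J x)))"
    by (rule bounded_clinear_compose[OF K' bounded_clinear_compose[OF M bounded_clinear_cadjoint[OF J']]])
  then have F: "bounded_clinear (F k)" for k
    unfolding F_def by (rule bounded_clinear_sandwich_power)
  obtain m where "m > 0" "\<And>x. norm (F 0 x) \<le> norm x * m"
    using bounded_linear.pos_bounded[OF bounded_clinear_imp_bounded_linear[OF F]] by blast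
  then have F_le: "norm (F k x) \<le> m * norm x" for k x
    unfolding F_def by (intro norm_sandwich_power_le) (simp_all add: mult.commute)
  have F_Suc: "F (Suc k) = sandwich T S (F k)" for k
    by (simp add: F_def)
  have F_S: "F (Suc k) (S i x) = T i (F k x)" for k i x
    unfolding F_Suc by (rule sandwich_S[OF F])
  \<comment> \<open>The adjoints pass through \<open>J\<close>, \<open>M\<close> and
    \<open>K\<close> in turn, by both dilation equations and \<open>inter\<close>.\<close>
  have F_J: "F k (J v) = T.range_projection k (K (M v))" for k v
  proof (induction k arbitrary: v)
    case 0
    then show ?case by (simp add: F_def cadjoint_isometry[OF J(1)])
  next
    case (Suc k)
    have "F (Suc k) (J v) = (\<Sum>i\<in>UNIV. T i (F k (J (cadjoint (A i) v))))"
      by (simp only: F_Suc sandwich_def J(2))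
    also have "\<dots> = T.range_projection (Suc k) (K (M v))"
      by (simp only: Suc.IH T.range_projection_Suc inter K(2))
    finally show ?case .
  qed
  have "x \<in> {x. convergent (\<lambda>k. F k x)}" for x
    using dilS
  proof (rule minimal_isometric_dilation_induct)
    show "closed {x. convergent (\<lambda>k. F k x)}"
      by (rule closed_convergent_bounded_clinear[OF F F_le])
    show "complex_vector.subspace {x. convergent (\<lambda>k. F k x)}"
      by (rule subspace_convergent_bounded_clinear[OF F])
    show "J v \<in> {x. convergent (\<lambda>k. F k x)}" for v
      by (simp add: F_J T.convergent_range_projection)
    fix i x assume "x \<in> {x. convergent (\<lambda>k. F k x)}"
    then have "convergent (\<lambda>k. F (Suc k) (S i x))"
      unfolding F_S convergent_def using bounded_clinear_tendsto[OF T.clinear] by blast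
    then show "S i x \<in> {x. convergent (\<lambda>k. F k x)}"
      using convergent_Suc_iff[of "\<lambda>k. F k (S i x)"] by simp
  qed
  then have lim: "(\<lambda>k. F k x) \<longlonglongrightarrow> lim (\<lambda>k. F k x)" for x
    by (simp add: convergent_LIMSEQ_iff)
  define X where "X x = lim (\<lambda>k. F k x)" for x
  have lim: "(\<lambda>k. F k x) \<longlonglongrightarrow> X x" for x
    using lim by (simp add: X_def)
  show ?thesis
  proof (rule that)
    show "bounded_clinear X"
      by (rule bounded_clinear_pointwise_limit[OF F F_le lim])
    show "sandwich T S X x = X x" for x
    proof (rule LIMSEQ_unique)
      show "(\<lambda>k. F (Suc k) x) \<longlonglongrightarrow> sandwich T S X x"
        unfolding F_Suc sandwich_def
        by (intro tendsto_sum bounded_clinear_tendsto[OF T.clinear] lim)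
      show "(\<lambda>k. F (Suc k) x) \<longlonglongrightarrow> X x" by (rule LIMSEQ_Suc[OF lim])
    qed
    show "X (J v) = cuntz_projection T (K (M v))" for v
      using lim[of "J v"] T.tendsto_cuntz_projection unfolding F_J by (rule LIMSEQ_unique)
  qed
qed

end

text \<open>Both operators commute with every \<open>S i\<close> and agree on the range of
  \<open>J\<close>, so minimality makes them equal.\<close>

lemma (in row_isometry) eq_cuntz_projectionI:
  assumes dil: "minimal_isometric_dilation A J S"
    and W: "bounded_clinear W" "\<And>i x. W (S i x) = S i (W x)"
    and J: "\<And>v. W (J v) = cuntz_projection S (J v)"
  shows "W x = cuntz_projection S x"
proof -
  note P = bounded_clinear_cuntz_projection
  have "x \<in> {x. W x = cuntz_projection S x}"
    using dil
  proof (rule minimal_isometric_dilation_induct)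
    show "closed {x. W x = cuntz_projection S x}"
      by (intro closed_Collect_eq linear_continuous_on bounded_clinear_imp_bounded_linear W P)
    show "complex_vector.subspace {x. W x = cuntz_projection S x}"
      by (rule complex_vector.subspaceI)
        (simp_all add: bounded_clinear_zero[OF W(1)] bounded_clinear_zero[OF P]
          bounded_clinear_add[OF W(1)] bounded_clinear_add[OF P]
          bounded_clinear_scaleC[OF W(1)] bounded_clinear_scaleC[OF P])
  qed (simp_all add: J W(2) cuntz_projection_S)
  then show ?thesis by simp
qed

theorem corollary7p3:
  fixes A B :: "'i::finite \<Rightarrow> 'v::complex_hilbert_space \<Rightarrow> 'v"
    and S :: "'i \<Rightarrow> 'h::complex_hilbert_space \<Rightarrow> 'h"
    and T :: "'i \<Rightarrow> 'k::complex_hilbert_space \<Rightarrow> 'k"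
    and J :: "'v \<Rightarrow> 'h" and K :: "'v \<Rightarrow> 'k"
  assumes "CARD('i) \<ge> 2"
    and "finite_dimensional TYPE('v)"
    and "contractive_tuple A" and "contractive_tuple B"
    and "similar_tuples A B"
    and "minimal_isometric_dilation A J S"
    and "minimal_isometric_dilation B K T"
  shows "unitarily_equivalent (cuntz_part S) (cuntz_part T)"
proof -
  interpret S: row_isometry S
    by (rule minimal_isometric_dilation_row_isometry) fact
  interpret T: row_isometry T
    by (rule minimal_isometric_dilation_row_isometry) fact
  interpret ST: row_isometry_pair S T ..
  interpret TS: row_isometry_pair T S ..
  obtain R R' where R: "bounded_clinear R" "bounded_clinear R'" "R \<circ> R' = id" "R' \<circ> R = id"
      and B: "\<And>i. B i = R \<circ> A i \<circ> R'"
    using \<open>similar_tuples A B\<close> by (auto simp: similar_tuples_def)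
  have A: "bounded_clinear (A i)" for i
    using \<open>contractive_tuple A\<close> by (simp add: contractive_tuple_def)
  let ?M = "cadjoint R'" and ?N = "cadjoint R"
  have M: "bounded_clinear ?M" and N: "bounded_clinear ?N"
    using R by (auto intro: bounded_clinear_cadjoint)
  have MN: "?M (?N v) = v" and NM: "?N (?M v) = v" for v
    using R by (simp_all add: cadjoint_id flip: cadjoint_compose)
  \<comment> \<open>Adjoints reverse products. Since \<open>?N\<close> inverts \<open>?M\<close>, it
    follows that \<open>?M\<close> intertwines the adjoints of \<open>A\<close> with those of
    \<open>B\<close>, and \<open>?N\<close> does so in the opposite direction.\<close>
  have B': "cadjoint (B i) v = ?M (cadjoint (A i) (?N v))" for i v
  proof -
    have "bounded_clinear (R \<circ> A i)"
      using bounded_clinear_compose[OF R(1) A] by (simp add: comp_def)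
    then show ?thesis by (simp add: B cadjoint_compose R A)
  qed
  obtain X where X: "bounded_clinear X" "\<And>x. sandwich T S X x = X x"
      and XJ: "\<And>v. X (J v) = cuntz_projection T (K (?M v))"
    using ST.exists_dilation_intertwiner[OF assms(6,7) M] by (auto simp: B' NM)
  obtain Y where Y: "bounded_clinear Y" "\<And>x. sandwich S T Y x = Y x"
      and YK: "\<And>v. Y (K v) = cuntz_projection S (J (?N v))"
    using TS.exists_dilation_intertwiner[OF assms(7,6) N] by (auto simp: B' NM)
  \<comment> \<open>On the range of \<open>J\<close>: \<open>X (J v)\<close> is the Cuntz component
    of \<open>K (?M v)\<close>. As \<open>Y\<close> absorbs that projection, the result is the Cuntz
    component of \<open>J (?N (?M v))\<close>, where \<open>?N\<close> cancels
    \<open>?M\<close>.\<close>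
  have "Y (X x) = cuntz_projection S x" for x
    by (rule S.eq_cuntz_projectionI[OF assms(6) bounded_clinear_compose[OF Y(1) X(1)]])
      (simp_all add: ST.fixed_S[OF X] TS.fixed_S[OF Y] XJ TS.fixed_cuntz_projection[OF Y] YK NM)
  moreover have "X (Y y) = cuntz_projection T y" for y
    by (rule T.eq_cuntz_projectionI[OF assms(7) bounded_clinear_compose[OF X(1) Y(1)]])
      (simp_all add: ST.fixed_S[OF X] TS.fixed_S[OF Y] YK ST.fixed_cuntz_projection[OF X] XJ MN)
  ultimately show ?thesis
    by (rule ST.unitarily_equivalent_cuntz_part[OF X Y(1)])
qed

end
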